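(* For every integer $n\geq 1$, $$\sum_{T\in\mathcal{B}_n}x^{\mathrm{xleaf}(T)}y^{\mathrm{yleaf}(T)}\left(\frac{\alpha+\beta}{2}\right)^{N_\alpha(T)+N_\beta(T)}=\sum_{P\in\mathcal{P}_n}w(P),$$ where $\mathcal{B}_n$ is the set of increasing binary trees on $[n]$, $\mathcal{P}_n$ is the set of forests of planted increasing 0-1-2-plane trees on $[2,n]=\{2,3,\dots,n\}$, and the weight $w(P)$ of $P\in\mathcal{P}_n$ is the product of the following vertex labels: a single root is labeled $(x+y)\frac{\alpha+\beta}{2}$; the root of a component with at least two vertices is labeled $\alpha+\beta$; a non-root vertex with exactly one child is labeled $x+y$; a leaf (non-root vertex with no children) is labeled $xy$; a vertex with two children has label $1$.
   Context: An increasing binary tree on $[n]=\{1,\dots,n\}$ is a complete (full) rooted binary tree whose internal vertices are labeled bijectively by $[n]$, such that every internal vertex has exactly one left child and one right child, each being either an internal vertex or an (unlabeled, external) leaf, and such that labels of internal vertices increase along every path going away from the root. In such a tree $T$, the $a$-leaf is the leaf reached from the root by always moving to the left child, and the $b$-leaf is the leaf reached from the root by always moving to the right child. An $x$-leaf is a leaf, other than the $a$-leaf and the $b$-leaf, that is a left child; a $y$-leaf is a leaf, other than the $a$-leaf and the $b$-leaf, that is a right child. $\mathrm{xleaf}(T)$ and $\mathrm{yleaf}(T)$ are the numbers of $x$-leaves and $y$-leaves of $T$. An $\alpha$-vertex is an internal vertex other than the root lying on the path from the root to the $a$-leaf; a $\beta$-vertex is an internal vertex other than the root lying on the path from the root to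 the $b$-leaf. $N_\alpha(T)$ and $N_\beta(T)$ are the numbers of $\alpha$-vertices and $\beta$-vertices of $T$. An increasing 0-1-2-plane tree on a nonempty finite set $V$ of integers is a rooted plane tree whose vertices are labeled bijectively by $V$, in which every vertex has $0$, $1$ or $2$ children, the children of a vertex with two children are linearly ordered (left/right), a sole child carries no left/right distinction, and labels increase along every path going away from the root. A planted increasing 0-1-2-plane tree on a nonempty finite set $U$ is a root labeled $\min U$ which is either a single vertex (a single root, when $|U|=1$) or has exactly one child, this child being the root of an increasing 0-1-2-plane tree on $U\setminus\{\min U\}$. A forest of such trees on $[2,n]$ is an unordered collection of planted increasing 0-1-2-plane trees whose label sets partition $[2,n]$; for $n=1$ there is only the empty forest, of weight $1$. *)

theory Defs
  imports Complex_Main "HOL-Library.Tree" "HOL-Library.Sublist" "HOL-Library.Disjoint_Sets"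
begin

text \<open>
  A value of the library type of binary trees is a full binary tree: the internal vertices are
  the \<open>Node\<close>s and the external leaves are the \<open>Leaf\<close>s. The library predicate \<open>heap\<close> only asks
  for weakly increasing labels; together with \<open>distinct\<close> the labels increase strictly.
\<close>

definition increasing_binary_trees :: "nat \<Rightarrow> nat tree set" where
  "increasing_binary_trees n =
     {T. distinct (inorder T) \<and> set_tree T = {1..n} \<and> heap T}"

text \<open>
  A position in a binary tree (an internal vertex or an external leaf) is identified by the
  sequence of left/right moves leading to it from the root.
\<close>

datatype dir = Lft | Rgt

fun leaf_positions :: "'a tree \<Rightarrow> dir list set" where
  "leaf_positions Leaf = {[]}"
| "leaf_positions (Node l v r) =
     (#) Lft ` leaf_positions l \<union> (#) Rgt ` leaf_positions r"

fun internal_positions :: "'a tree \<Rightarrow> dir list set" where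
  "internal_positions Leaf = {}"
| "internal_positions (Node l v r) =
     {[]} \<union> (#) Lft ` internal_positions l \<union> (#) Rgt ` internal_positions r"

fun a_leaf :: "'a tree \<Rightarrow> dir list" where
  "a_leaf Leaf = []"
| "a_leaf (Node l v r) = Lft # a_leaf l"

fun b_leaf :: "'a tree \<Rightarrow> dir list" where
  "b_leaf Leaf = []"
| "b_leaf (Node l v r) = Rgt # b_leaf r"

definition x_leaves :: "'a tree \<Rightarrow> dir list set" where
  "x_leaves T =
     {p \<in> leaf_positions T. p \<noteq> a_leaf T \<and> p \<noteq> b_leaf T \<and> p \<noteq> [] \<and> last p = Lft}"

definition y_leaves :: "'a tree \<Rightarrow> dir list set" where
  "y_leaves T =
     {p \<in> leaf_positions T. p \<noteq> a_leaf T \<and> p \<noteq> b_leaf T \<and> p \<noteq> [] \<and> last p = Rgt}"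

definition xleaf :: "'a tree \<Rightarrow> nat" where
  "xleaf T = card (x_leaves T)"

definition yleaf :: "'a tree \<Rightarrow> nat" where
  "yleaf T = card (y_leaves T)"

text \<open>
  A vertex lies on the path from the root to a leaf iff its position is a prefix of that of
  the leaf; the root is the position \<open>[]\<close>.
\<close>

definition alpha_vertices :: "'a tree \<Rightarrow> dir list set" where
  "alpha_vertices T = {p \<in> internal_positions T. p \<noteq> [] \<and> prefix p (a_leaf T)}"

definition beta_vertices :: "'a tree \<Rightarrow> dir list set" where
  "beta_vertices T = {p \<in> internal_positions T. p \<noteq> [] \<and> prefix p (b_leaf T)}"

definition N_alpha :: "'a tree \<Rightarrow> nat" where
  "N_alpha T = card (alpha_vertices T)"

definition N_beta :: "'a tree \<Rightarrow> nat" where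
  "N_beta T = card (beta_vertices T)"

datatype 'a tree012 =
    Vertex0 'a
  | Vertex1 'a "'a tree012"
  | Vertex2 'a "'a tree012" "'a tree012"

fun labels012 :: "'a tree012 \<Rightarrow> 'a list" where
  "labels012 (Vertex0 v) = [v]"
| "labels012 (Vertex1 v t) = v # labels012 t"
| "labels012 (Vertex2 v l r) = v # labels012 l @ labels012 r"

fun increasing012 :: "'a::linorder tree012 \<Rightarrow> bool" where
  "increasing012 (Vertex0 v) \<longleftrightarrow> True"
| "increasing012 (Vertex1 v t) \<longleftrightarrow> (\<forall>u \<in> set (labels012 t). v < u) \<and> increasing012 t"
| "increasing012 (Vertex2 v l r) \<longleftrightarrow>
     (\<forall>u \<in> set (labels012 l) \<union> set (labels012 r). v < u) \<and> increasing012 l \<and> increasing012 r"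

definition increasing_tree012_on :: "'a::linorder set \<Rightarrow> 'a tree012 \<Rightarrow> bool" where
  "increasing_tree012_on V t \<longleftrightarrow>
     distinct (labels012 t) \<and> set (labels012 t) = V \<and> increasing012 t"

datatype 'a planted =
    Single_Root 'a
  | Planted_Root 'a "'a tree012"

fun planted_labels :: "'a planted \<Rightarrow> 'a set" where
  "planted_labels (Single_Root v) = {v}"
| "planted_labels (Planted_Root v t) = insert v (set (labels012 t))"

fun planted_tree_on :: "'a::linorder set \<Rightarrow> 'a planted \<Rightarrow> bool" where
  "planted_tree_on U (Single_Root v) \<longleftrightarrow> U = {v}"
| "planted_tree_on U (Planted_Root v t) \<longleftrightarrow>
     finite U \<and> U \<noteq> {} \<and> v = Min U \<and> increasing_tree012_on (U - {v}) t"

text \<open>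
  Since the (nonempty) label sets of the components are disjoint, no component is repeated and
  the forest is a set of planted trees. The condition \<open>inj_on\<close> excludes two distinct components
  with the same label set, which \<open>partition_on\<close> alone does not see.
\<close>

definition planted_forests :: "nat \<Rightarrow> nat planted set set" where
  "planted_forests n =
     {P. (\<forall>t \<in> P. planted_tree_on (planted_labels t) t) \<and>
         inj_on planted_labels P \<and> partition_on {2..n} (planted_labels ` P)}"

fun weight012 :: "'b::comm_ring_1 \<Rightarrow> 'b \<Rightarrow> 'a tree012 \<Rightarrow> 'b" where
  "weight012 x y (Vertex0 v) = x * y"
| "weight012 x y (Vertex1 v t) = (x + y) * weight012 x y t"
| "weight012 x y (Vertex2 v l r) = 1 * weight012 x y l * weight012 x y r"

fun planted_weight :: "'b::field_char_0 \<Rightarrow> 'b \<Rightarrow> 'b \<Rightarrow> 'b \<Rightarrow> 'a planted \<Rightarrow> 'b" where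
  "planted_weight x y \<alpha> \<beta> (Single_Root v) = (x + y) * ((\<alpha> + \<beta>) / 2)"
| "planted_weight x y \<alpha> \<beta> (Planted_Root v t) = (\<alpha> + \<beta>) * weight012 x y t"

definition forest_weight ::
    "'b::field_char_0 \<Rightarrow> 'b \<Rightarrow> 'b \<Rightarrow> 'b \<Rightarrow> 'a planted set \<Rightarrow> 'b" where
  "forest_weight x y \<alpha> \<beta> P = (\<Prod>t \<in> P. planted_weight x y \<alpha> \<beta> t)"

end

theory Submission
  imports Defs
begin

text \<open>
  Both sides are values of set functions. The convolution below is the product of such
  functions (that of exponential generating functions), and \<open>A \<mapsto> f (insert m A)\<close> with \<open>m\<close>
  smaller than \<open>A\<close> is the derivative. Write \<open>c = (\<alpha> + \<beta>) / 2\<close>. Let \<open>F\<close> be the generating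
  function of nonempty increasing binary trees weighted by their left and right leaves, and
  \<open>L\<close>, \<open>R\<close> those of the left and the right subtree of the root. Removing the minimal label gives
  \<open>F' = (x + F) (y + F)\<close>, \<open>L' = c L (y + F)\<close> and \<open>R' = c (x + F) R\<close>, so that
  \<open>(L R)' = c (x + y + 2 F) L R\<close>. Increasing 0-1-2-plane trees satisfy the differential equation
  \<open>F' = xy + (x + y) F + F\<^sup>2\<close>, which is that of \<open>F\<close>, and removing the component of the minimal
  label shows that forests satisfy that of \<open>L R\<close>.
\<close>

section \<open>Convolution of set functions\<close>

definition set_conv :: "('a set \<Rightarrow> 'b::comm_ring_1) \<Rightarrow> ('a set \<Rightarrow> 'b) \<Rightarrow> 'a set \<Rightarrow> 'b" where
  "set_conv f g A = (\<Sum>S \<in> Pow A. f S * g (A - S))"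

definition set_unit :: "'a set \<Rightarrow> 'b::comm_ring_1" where
  "set_unit A = (if A = {} then 1 else 0)"

lemma set_conv_cong:
  assumes "\<And>S. S \<subseteq> A \<Longrightarrow> f S = f' S" "\<And>S. S \<subseteq> A \<Longrightarrow> g S = g' S"
  shows "set_conv f g A = set_conv f' g' A"
  unfolding set_conv_def using assms by (intro sum.cong) auto

lemma set_conv_empty [simp]: "set_conv f g {} = f {} * g {}"
  by (simp add: set_conv_def)

lemma set_conv_add_left: "set_conv (\<lambda>S. f S + g S) h A = set_conv f h A + set_conv g h A"
  by (simp add: set_conv_def algebra_simps sum.distrib)

lemma set_conv_scale_left: "set_conv (\<lambda>S. c * f S) h A = c * set_conv f h A"
  by (simp add: set_conv_def sum_distrib_left mult.assoc)

lemma set_conv_commute: "set_conv f g A = set_conv g f A"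
  unfolding set_conv_def
  by (rule sum.reindex_bij_witness[of _ "\<lambda>S. A - S" "\<lambda>S. A - S"])
    (auto simp: double_diff mult.commute)

lemma set_conv_add_right: "set_conv h (\<lambda>S. f S + g S) A = set_conv h f A + set_conv h g A"
  by (simp only: set_conv_commute[of h] set_conv_add_left)

lemma set_conv_scale_right: "set_conv h (\<lambda>S. c * f S) A = c * set_conv h f A"
  by (simp only: set_conv_commute[of h] set_conv_scale_left)

lemma set_conv_unit_left:
  assumes "finite A"
  shows "set_conv set_unit f A = f A"
proof -
  have "set_conv set_unit f A = (\<Sum>S \<in> Pow A. if S = {} then f A else 0)"
    unfolding set_conv_def set_unit_def by (intro sum.cong) auto
  then show ?thesis using assms by simp
qed

lemma set_conv_unit_right: "finite A \<Longrightarrow> set_conv f set_unit A = f A"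
  by (subst set_conv_commute) (rule set_conv_unit_left)

text \<open>Both sides sum over the ordered splittings of \<open>A\<close> into three blocks. A
  nested pair \<open>T\<close>, \<open>S\<close> on the left corresponds to the disjoint pair
  \<open>T\<close>, \<open>S - T\<close> on the right.\<close>

lemma set_conv_assoc:
  assumes "finite A"
  shows "set_conv (set_conv f g) h A = set_conv f (set_conv g h) A"
proof -
  have diff: "A - T - (S - T) = A - S" if "T \<subseteq> S" for S T
    using that by blast
  have "set_conv (set_conv f g) h A =
      (\<Sum>(S, T) \<in> (SIGMA S:Pow A. Pow S). f T * g (S - T) * h (A - S))"
    using assms
    by (subst sum.Sigma [symmetric])
      (auto simp: set_conv_def sum_distrib_right intro: finite_subset)
  also have "\<dots> = (\<Sum>(T, U) \<in> (SIGMA T:Pow A. Pow (A - T)). f T * (g U * h (A - T - U)))"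
    by (rule sum.reindex_bij_witness[of _ "\<lambda>(T, U). (T \<union> U, T)" "\<lambda>(S, T). (T, S - T)"])
      (auto simp: mult.assoc diff)
  also have "\<dots> = set_conv f (set_conv g h) A"
    using assms
    by (subst sum.Sigma [symmetric])
      (auto simp: set_conv_def sum_distrib_left intro: finite_subset)
  finally show ?thesis .
qed

text \<open>The product rule for derivatives: \<open>m\<close> falls either into the block given to
  \<open>f\<close> or into the block given to \<open>g\<close>.\<close>

lemma set_conv_insert:
  assumes "finite A" "m \<notin> A"
  shows "set_conv f g (insert m A) =
    set_conv (\<lambda>S. f (insert m S)) g A + set_conv f (\<lambda>S. g (insert m S)) A"
proof -
  have inj: "inj_on (insert m) (Pow A)"
    using assms(2) by (auto simp: inj_on_def)
  have "set_conv f g (insert m A) = (\<Sum>S \<in> Pow A. f S * g (insert m A - S))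
      + (\<Sum>S \<in> insert m ` Pow A. f S * g (insert m A - S))"
    unfolding set_conv_def Pow_insert
    using assms by (intro sum.union_disjoint) auto
  also have "(\<Sum>S \<in> Pow A. f S * g (insert m A - S)) = set_conv f (\<lambda>S. g (insert m S)) A"
    unfolding set_conv_def using assms(2)
    by (intro sum.cong refl) (auto simp: insert_Diff_if intro!: arg_cong[where f = g])
  also have "(\<Sum>S \<in> insert m ` Pow A. f S * g (insert m A - S)) =
      set_conv (\<lambda>S. f (insert m S)) g A"
    unfolding set_conv_def using assms(2)
    by (subst sum.reindex[OF inj]) (auto simp: o_def intro!: sum.cong arg_cong[where f = g])
  finally show ?thesis by simp
qed

text \<open>Bridge from combinatorics to convolution: it applies whenever a structure amounts to an
  ordered pair of structures on complementary label sets and its weight is multiplicative.\<close>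

lemma sum_split_conv:
  assumes "finite A" "\<And>S. S \<subseteq> A \<Longrightarrow> finite (F S)" "\<And>S. S \<subseteq> A \<Longrightarrow> finite (G S)"
  shows "(\<Sum>(S, p, q) \<in> (SIGMA S:Pow A. F S \<times> G (A - S)). f p * g q) =
    set_conv (\<lambda>S. sum f (F S)) (\<lambda>S. sum g (G S)) A"
proof -
  have "(\<Sum>(S, p, q) \<in> (SIGMA S:Pow A. F S \<times> G (A - S)). f p * g q) =
      (\<Sum>S \<in> Pow A. \<Sum>(p, q) \<in> F S \<times> G (A - S). f p * g q)"
    using assms by (subst sum.Sigma) auto
  then show ?thesis
    by (simp add: set_conv_def sum_product sum.cartesian_product)
qed

text \<open>Matches the recursions below: removing the minimum \<open>m\<close> gives a convolution
  over \<open>A\<close>, whose value involves all subsets of \<open>A\<close>, so the hypothesis is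
  needed for each of them.\<close>

lemma finite_min_strong_induct [consumes 1, case_names empty insert]:
  fixes V :: "'a::linorder set"
  assumes "finite V" "P {}"
    and step: "\<And>m A. finite A \<Longrightarrow> \<forall>a \<in> A. m < a \<Longrightarrow> (\<And>S. S \<subseteq> A \<Longrightarrow> P S) \<Longrightarrow> P (insert m A)"
  shows "P V"
  using assms(1)
proof (induction rule: finite_psubset_induct)
  case (psubset V)
  show ?case
  proof (cases "V = {}")
    case False
    define A where "A = V - {Min V}"
    have V: "V = insert (Min V) A" using Min_in[OF psubset.hyps False] by (auto simp: A_def)
    have "\<forall>a \<in> A. Min V < a"
      using psubset.hyps False by (auto simp: A_def order.strict_iff_order)
    moreover have "P S" if "S \<subseteq> A" for S
      using that Min_in[OF psubset.hyps False] by (intro psubset.IH) (auto simp: A_def)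
    ultimately show ?thesis
      using step[of A "Min V"] psubset.hyps V by (simp add: A_def)
  qed (use assms(2) in simp)
qed

section \<open>Increasing binary trees\<close>

definition heap_trees :: "'a::linorder set \<Rightarrow> 'a tree set" where
  "heap_trees V = {T. distinct (inorder T) \<and> set_tree T = V \<and> heap T}"

lemma heap_trees_empty [simp]: "heap_trees {} = {Leaf}"
  by (auto simp: heap_trees_def)

text \<open>The minimal label must sit at the root. Recording the label set \<open>S\<close> of the
  left subtree indexes the pairs of subtrees by the splittings of \<open>A\<close>.\<close>

lemma heap_trees_insert:
  assumes "\<forall>a \<in> A. m < a"
  shows "heap_trees (insert m A) =
    (\<lambda>(S, l, r). Node l m r) ` (SIGMA S:Pow A. heap_trees S \<times> heap_trees (A - S))"
    (is "_ = ?h ` ?X")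
proof
  show "heap_trees (insert m A) \<subseteq> ?h ` ?X"
  proof
    fix T assume T: "T \<in> heap_trees (insert m A)"
    then obtain l v r where T_eq: "T = Node l v r"
      by (cases T) (auto simp: heap_trees_def)
    have set_eq: "insert v (set_tree l \<union> set_tree r) = insert m A"
      using T by (auto simp: heap_trees_def T_eq)
    have le: "\<forall>u \<in> set_tree l \<union> set_tree r. v \<le> u"
      using T by (auto simp: heap_trees_def T_eq)
    have dis: "v \<notin> set_tree l" "v \<notin> set_tree r" "set_tree l \<inter> set_tree r = {}"
      using T by (auto simp: heap_trees_def T_eq)
    have "v \<le> m" using set_eq le by auto
    moreover have "m \<le> v"
      using set_eq assms by (metis insertCI insertE order.strict_iff_order order_refl)
    ultimately have v: "v = m" by simp
    have "A = set_tree l \<union> set_tree r"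
      using set_eq dis v assms by (metis Un_iff insert_ident order.irrefl)
    then show "T \<in> ?h ` ?X"
      using T dis unfolding T_eq v
      by (intro image_eqI[of _ _ "(set_tree l, l, r)"]) (auto simp: heap_trees_def)
  qed
  show "?h ` ?X \<subseteq> heap_trees (insert m A)"
  proof -
    have "m \<notin> A" "\<forall>a \<in> A. m \<le> a" using assms by auto
    then show ?thesis by (fastforce simp: heap_trees_def)
  qed
qed

lemma inj_on_Node_split:
  "inj_on (\<lambda>(S, l, r). Node l m r) (SIGMA S:Pow A. heap_trees S \<times> heap_trees (A - S))"
  by (auto simp: inj_on_def heap_trees_def)

lemma finite_heap_trees: "finite V \<Longrightarrow> finite (heap_trees V)"
proof (induction rule: finite_min_strong_induct)
  case (insert m A)
  then show ?case
    by (subst heap_trees_insert) (auto intro!: finite_imageI finite_SigmaI finite_cartesian_product)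
qed simp

text \<open>The common source of all differential equations for binary trees: only the factorization
  of the weight at the root has to be supplied.\<close>

lemma sum_heap_trees_insert:
  assumes "finite A" "\<forall>a \<in> A. m < a"
    and "\<And>l r. w (Node l m r) = f l * g r"
  shows "sum w (heap_trees (insert m A)) =
    set_conv (\<lambda>S. sum f (heap_trees S)) (\<lambda>S. sum g (heap_trees S)) A"
proof -
  have "sum w (heap_trees (insert m A)) =
      (\<Sum>(S, l, r) \<in> (SIGMA S:Pow A. heap_trees S \<times> heap_trees (A - S)). f l * g r)"
    unfolding heap_trees_insert[OF assms(2)] sum.reindex[OF inj_on_Node_split]
    by (intro sum.cong) (auto simp: assms(3))
  also have "\<dots> = set_conv (\<lambda>S. sum f (heap_trees S)) (\<lambda>S. sum g (heap_trees S)) A"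
    using assms(1) by (intro sum_split_conv finite_heap_trees) (auto intro: finite_subset)
  finally show ?thesis .
qed

section \<open>Weights of binary trees that factor at the root\<close>

text \<open>The parameter \<open>u\<close> is the weight of the tree when it is a mere leaf.\<close>

fun leaf_weight :: "'b::comm_ring_1 \<Rightarrow> 'b \<Rightarrow> 'b \<Rightarrow> 'a tree \<Rightarrow> 'b" where
  "leaf_weight x y u Leaf = u"
| "leaf_weight x y u (Node l v r) = leaf_weight x y x l * leaf_weight x y y r"

text \<open>Meant for the left subtree of the root of a larger tree: its left spine ends in the
  \<open>a\<close>-leaf, which counts 1, its spine vertices are the alpha-vertices, each counting
  \<open>c\<close>, and whatever hangs to the right of the spine is weighted by its leaves.
  \<open>right_weight\<close> is the mirror image.\<close>

fun left_weight :: "'b::comm_ring_1 \<Rightarrow> 'b \<Rightarrow> 'b \<Rightarrow> 'a tree \<Rightarrow> 'b" where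
  "left_weight x y c Leaf = 1"
| "left_weight x y c (Node l v r) = (c * left_weight x y c l) * leaf_weight x y y r"

fun right_weight :: "'b::comm_ring_1 \<Rightarrow> 'b \<Rightarrow> 'b \<Rightarrow> 'a tree \<Rightarrow> 'b" where
  "right_weight x y c Leaf = 1"
| "right_weight x y c (Node l v r) = leaf_weight x y x l * (c * right_weight x y c r)"

section \<open>Leaf and spine counts by position\<close>

text \<open>
  The leaves of \<open>t\<close> that are children in direction \<open>e\<close>, when \<open>t\<close> itself hangs below a vertex
  in direction \<open>d\<close>.
\<close>

definition dir_leaves :: "dir \<Rightarrow> dir \<Rightarrow> 'a tree \<Rightarrow> dir list set" where
  "dir_leaves d e t = {p \<in> leaf_positions t. last (d # p) = e}"

lemma finite_leaf_positions [simp]: "finite (leaf_positions t)"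
  by (induction t) auto

lemma finite_internal_positions [simp]: "finite (internal_positions t)"
  by (induction t) auto

lemma finite_dir_leaves [simp]: "finite (dir_leaves d e t)"
  by (simp add: dir_leaves_def)

lemma dir_leaves_Leaf [simp]: "dir_leaves d e Leaf = (if d = e then {[]} else {})"
  by (auto simp: dir_leaves_def)

lemma dir_leaves_Node [simp]: "dir_leaves d e (Node l v r) =
    (#) Lft ` dir_leaves Lft e l \<union> (#) Rgt ` dir_leaves Rgt e r"
  by (auto simp: dir_leaves_def)

lemma card_Lft_Rgt_Un:
  assumes "finite A" "finite B"
  shows "card ((#) Lft ` A \<union> (#) Rgt ` B) = card A + card B"
proof -
  have "card ((#) Lft ` A \<union> (#) Rgt ` B) = card ((#) Lft ` A) + card ((#) Rgt ` B)"
    using assms by (intro card_Un_disjoint) auto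
  then show ?thesis by (simp add: card_image)
qed

text \<open>The \<open>case\<close> expression is the weight of a mere leaf hanging in direction
  \<open>d\<close>. The direction is arbitrary in the induction because the two subtrees hang in
  different directions.\<close>

lemma leaf_weight_eq:
  "leaf_weight x y (case d of Lft \<Rightarrow> x | Rgt \<Rightarrow> y) t =
    x ^ card (dir_leaves d Lft t) * y ^ card (dir_leaves d Rgt t)"
proof (induction t arbitrary: d)
  case Leaf
  then show ?case by (cases d) auto
next
  case (Node l v r)
  then show ?case
    using Node.IH(1)[of Lft] Node.IH(2)[of Rgt]
    by (simp add: card_Lft_Rgt_Un power_add algebra_simps)
qed

lemma leaf_weight_Lft:
  "leaf_weight x y x t = x ^ card (dir_leaves Lft Lft t) * y ^ card (dir_leaves Lft Rgt t)"
  using leaf_weight_eq[where d = Lft] by simp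

lemma leaf_weight_Rgt:
  "leaf_weight x y y t = x ^ card (dir_leaves Rgt Lft t) * y ^ card (dir_leaves Rgt Rgt t)"
  using leaf_weight_eq[where d = Rgt] by simp

text \<open>The \<open>a\<close>-leaf of a node is that of its left subtree, so the right part loses
  nothing.\<close>

lemma dir_leaves_minus_a_leaf: "dir_leaves d e (Node l v r) - {a_leaf (Node l v r)} =
    (#) Lft ` (dir_leaves Lft e l - {a_leaf l}) \<union> (#) Rgt ` dir_leaves Rgt e r"
  by auto

lemma dir_leaves_minus_b_leaf: "dir_leaves d e (Node l v r) - {b_leaf (Node l v r)} =
    (#) Lft ` dir_leaves Lft e l \<union> (#) Rgt ` (dir_leaves Rgt e r - {b_leaf r})"
  by auto

text \<open>Unlike \<open>alpha_vertices\<close>, this includes the root, since the root of a left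
  subtree is an alpha-vertex of the whole tree.\<close>

definition left_spine :: "'a tree \<Rightarrow> dir list set" where
  "left_spine t = {p \<in> internal_positions t. prefix p (a_leaf t)}"

definition right_spine :: "'a tree \<Rightarrow> dir list set" where
  "right_spine t = {p \<in> internal_positions t. prefix p (b_leaf t)}"

lemma left_spine_Node: "left_spine (Node l v r) = insert [] ((#) Lft ` left_spine l)"
  by (auto simp: left_spine_def)

lemma right_spine_Node: "right_spine (Node l v r) = insert [] ((#) Rgt ` right_spine r)"
  by (auto simp: right_spine_def)

lemma finite_spines [simp]: "finite (left_spine t)" "finite (right_spine t)"
  by (auto simp: left_spine_def right_spine_def)

text \<open>The value 1 at \<open>Leaf\<close> fits because its only leaf position is the
  \<open>a\<close>-leaf, which is removed. At a node the spine gains one vertex, and the right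
  subtree is counted in full.\<close>

lemma left_weight_eq:
  "left_weight x y c t = x ^ card (dir_leaves Lft Lft t - {a_leaf t}) *
    y ^ card (dir_leaves Lft Rgt t - {a_leaf t}) * c ^ card (left_spine t)"
proof (induction t)
  case Leaf
  then show ?case by (simp add: left_spine_def)
next
  case (Node l v r)
  have "card (left_spine (Node l v r)) = Suc (card (left_spine l))"
    unfolding left_spine_Node by (subst card_insert_disjoint) (auto simp: card_image)
  then show ?case
    unfolding dir_leaves_minus_a_leaf left_weight.simps Node.IH leaf_weight_Rgt
    by (simp add: card_Lft_Rgt_Un power_add algebra_simps)
qed

lemma right_weight_eq:
  "right_weight x y c t = x ^ card (dir_leaves Rgt Lft t - {b_leaf t}) *
    y ^ card (dir_leaves Rgt Rgt t - {b_leaf t}) * c ^ card (right_spine t)"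
proof (induction t)
  case Leaf
  then show ?case by (simp add: right_spine_def)
next
  case (Node l v r)
  have "card (right_spine (Node l v r)) = Suc (card (right_spine r))"
    unfolding right_spine_Node by (subst card_insert_disjoint) (auto simp: card_image)
  then show ?case
    unfolding dir_leaves_minus_b_leaf right_weight.simps Node.IH leaf_weight_Lft
    by (simp add: card_Lft_Rgt_Un power_add algebra_simps)
qed

text \<open>Below a root the \<open>a\<close>-leaf lies in the left subtree and the
  \<open>b\<close>-leaf in the right one, so each subtree loses just one of them.\<close>

lemma x_leaves_Node: "x_leaves (Node l v r) =
    (#) Lft ` (dir_leaves Lft Lft l - {a_leaf l}) \<union> (#) Rgt ` (dir_leaves Rgt Lft r - {b_leaf r})"
  by (auto simp: x_leaves_def dir_leaves_def)

lemma y_leaves_Node: "y_leaves (Node l v r) =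
    (#) Lft ` (dir_leaves Lft Rgt l - {a_leaf l}) \<union> (#) Rgt ` (dir_leaves Rgt Rgt r - {b_leaf r})"
  by (auto simp: y_leaves_def dir_leaves_def)

lemma alpha_vertices_Node: "alpha_vertices (Node l v r) = (#) Lft ` left_spine l"
  by (auto simp: alpha_vertices_def left_spine_def)

lemma beta_vertices_Node: "beta_vertices (Node l v r) = (#) Rgt ` right_spine r"
  by (auto simp: beta_vertices_def right_spine_def)

text \<open>The alpha-vertices all lie in \<open>l\<close> and the beta-vertices in
  \<open>r\<close>, so the weight of the theorem splits into one factor per subtree.\<close>

lemma binary_tree_weight_Node:
  fixes x y c :: "'b::comm_ring_1"
  shows "x ^ xleaf (Node l v r) * y ^ yleaf (Node l v r) *
      c ^ (N_alpha (Node l v r) + N_beta (Node l v r)) =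
    left_weight x y c l * right_weight x y c r"
  unfolding xleaf_def yleaf_def N_alpha_def N_beta_def left_weight_eq right_weight_eq
    x_leaves_Node y_leaves_Node alpha_vertices_Node beta_vertices_Node
  by (simp add: card_Lft_Rgt_Un card_image power_add algebra_simps)

section \<open>Increasing 0-1-2-plane trees\<close>

definition trees012 :: "'a::linorder set \<Rightarrow> 'a tree012 set" where
  "trees012 V = {t. increasing_tree012_on V t}"

lemma labels012_nonempty [simp]: "labels012 t \<noteq> []"
  by (cases t) auto

lemma trees012_empty [simp]: "trees012 {} = {}"
  by (auto simp: trees012_def increasing_tree012_on_def)

text \<open>The root carries the minimum \<open>m\<close>; the three sets are the cases of 0, 1 and
  2 children.\<close>

lemma trees012_insert:
  assumes "\<forall>a \<in> A. m < a"
  shows "trees012 (insert m A) = (if A = {} then {Vertex0 m} else {}) \<union>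
    (Vertex1 m ` trees012 A \<union>
     (\<lambda>(S, l, r). Vertex2 m l r) ` (SIGMA S:Pow A. trees012 S \<times> trees012 (A - S)))"
    (is "_ = ?X0 \<union> (?X1 \<union> ?h ` ?X2)")
proof
  \<comment> \<open>\<open>v\<close> stands for the root label and \<open>B\<close> for the set of
    labels below the root; this serves all three cases.\<close>
  have min_eq: "v = m \<and> B = A"
    if "insert v B = insert m A" "\<forall>u \<in> B. v < u" for v and B :: "'a set"
  proof -
    have "v = m" using that assms by (metis insertCI insertE less_asym')
    then show ?thesis using that assms by (metis insert_ident order.irrefl)
  qed
  show "trees012 (insert m A) \<subseteq> ?X0 \<union> (?X1 \<union> ?h ` ?X2)"
  proof
    fix t assume t: "t \<in> trees012 (insert m A)"
    show "t \<in> ?X0 \<union> (?X1 \<union> ?h ` ?X2)"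
    proof (cases t)
      case (Vertex0 v)
      then show ?thesis
        using t min_eq[of v "{}"] by (auto simp: trees012_def increasing_tree012_on_def)
    next
      case (Vertex1 v s)
      then have "v = m \<and> set (labels012 s) = A"
        using t by (intro min_eq) (auto simp: trees012_def increasing_tree012_on_def)
      then show ?thesis
        using t Vertex1 by (auto simp: trees012_def increasing_tree012_on_def)
    next
      case (Vertex2 v l r)
      then have eq: "v = m \<and> set (labels012 l) \<union> set (labels012 r) = A"
        using t by (intro min_eq) (auto simp: trees012_def increasing_tree012_on_def)
      have "t \<in> ?h ` ?X2"
        using t eq unfolding Vertex2
        by (intro image_eqI[of _ _ "(set (labels012 l), l, r)"])
          (auto simp: trees012_def increasing_tree012_on_def)
      then show ?thesis by blast
    qed
  qed
  show "?X0 \<union> (?X1 \<union> ?h ` ?X2) \<subseteq> trees012 (insert m A)"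
  proof -
    have "m \<notin> A" using assms by auto
    then show ?thesis
      using assms
      by (auto simp: trees012_def increasing_tree012_on_def split: if_splits; blast)
  qed
qed

lemma inj_on_Vertex2_split:
  "inj_on (\<lambda>(S, l, r). Vertex2 m l r) (SIGMA S:Pow A. trees012 S \<times> trees012 (A - S))"
  by (auto simp: inj_on_def trees012_def increasing_tree012_on_def)

lemma finite_trees012: "finite V \<Longrightarrow> finite (trees012 V)"
proof (induction rule: finite_min_strong_induct)
  case (insert m A)
  then show ?case
    by (subst trees012_insert) (auto intro!: finite_imageI finite_SigmaI finite_cartesian_product)
qed simp

text \<open>The equation \<open>Q' = xy + (x + y) Q + Q\<^sup>2\<close>, one term per number of
  children of the root. Splittings with an empty block contribute 0, as no tree has an empty label
  set.\<close>

lemma sum_trees012_insert: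
  fixes x y :: "'b::comm_ring_1"
  assumes "finite A" "\<forall>a \<in> A. m < a"
  defines "Q \<equiv> \<lambda>S. sum (weight012 x y) (trees012 S)"
  shows "Q (insert m A) = x * y * set_unit A + (x + y) * Q A + set_conv Q Q A"
proof -
  let ?w = "weight012 x y"
  let ?h = "\<lambda>(S, l, r). Vertex2 m l r"
  let ?X = "SIGMA S:Pow A. trees012 S \<times> trees012 (A - S)"
  have fin: "finite (trees012 S)" if "S \<subseteq> A" for S
    using that assms(1) finite_subset by (intro finite_trees012) auto
  have finX: "finite ?X"
    using assms(1) fin by (auto intro!: finite_SigmaI finite_cartesian_product)
  have "Q (insert m A) = sum ?w (if A = {} then {Vertex0 m} else {}) +
      (sum ?w (Vertex1 m ` trees012 A) + sum ?w (?h ` ?X))"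
    unfolding Q_def trees012_insert[OF assms(2)] using fin finX
    by (subst sum.union_disjoint; (subst sum.union_disjoint)?) auto
  moreover have "sum ?w (Vertex1 m ` trees012 A) = (x + y) * Q A"
    by (subst sum.reindex) (auto simp: inj_on_def Q_def sum_distrib_left)
  moreover have "sum ?w (?h ` ?X) = (\<Sum>(S, l, r) \<in> ?X. ?w l * ?w r)"
    unfolding sum.reindex[OF inj_on_Vertex2_split] by (intro sum.cong) auto
  moreover have "\<dots> = set_conv Q Q A"
    unfolding Q_def using assms(1) fin by (intro sum_split_conv) auto
  ultimately show ?thesis by (simp add: set_unit_def)
qed

text \<open>With \<open>Q\<close> the 0-1-2-tree series, the two subtrees of a binary root
  contribute \<open>Q + x\<close> and \<open>Q + y\<close>; expanding their product gives the
  recursion of \<open>Q\<close>. The induction hypothesis is used at \<open>u = x\<close> and at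
  \<open>u = y\<close>.\<close>

lemma sum_leaf_weight_eq_sum_weight012:
  fixes x y u :: "'b::comm_ring_1"
  assumes "finite V"
  shows "sum (leaf_weight x y u) (heap_trees V) =
    sum (weight012 x y) (trees012 V) + u * set_unit V"
  using assms
proof (induction arbitrary: u rule: finite_min_strong_induct)
  case empty
  then show ?case by (simp add: set_unit_def)
next
  case (insert m A)
  let ?Q = "\<lambda>S. sum (weight012 x y) (trees012 S)"
  have "sum (leaf_weight x y u) (heap_trees (insert m A)) =
      set_conv (\<lambda>S. sum (leaf_weight x y x) (heap_trees S))
        (\<lambda>S. sum (leaf_weight x y y) (heap_trees S)) A"
    using insert.hyps by (intro sum_heap_trees_insert) auto
  also have "\<dots> = set_conv (\<lambda>S. ?Q S + x * set_unit S) (\<lambda>S. ?Q S + y * set_unit S) A"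
    by (intro set_conv_cong insert.IH)
  also have "\<dots> = set_conv ?Q ?Q A + (x + y) * ?Q A + x * y * set_unit A"
    using insert.hyps(1)
    by (simp add: set_conv_add_left set_conv_add_right set_conv_scale_left set_conv_scale_right
        set_conv_unit_left set_conv_unit_right algebra_simps)
  also have "\<dots> = ?Q (insert m A)"
    using insert.hyps by (simp add: sum_trees012_insert)
  \<comment> \<open>On a nonempty label set no tree is a mere leaf, so the term with
    \<open>u\<close> vanishes.\<close>
  finally show ?case by (simp add: set_unit_def)
qed

section \<open>Forests\<close>

definition components :: "'a::linorder set \<Rightarrow> 'a planted set" where
  "components U = {t. planted_labels t = U \<and> planted_tree_on U t}"

definition forests :: "'a::linorder set \<Rightarrow> 'a planted set set" where
  "forests V = {P. (\<forall>t \<in> P. planted_tree_on (planted_labels t) t) \<and>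
     disjoint_family_on planted_labels P \<and> \<Union> (planted_labels ` P) = V}"

lemma planted_labels_nonempty [simp]: "planted_labels t \<noteq> {}"
  by (cases t) auto

lemma inj_on_planted_labels:
  assumes "disjoint_family_on planted_labels P"
  shows "inj_on planted_labels P"
  using assms planted_labels_nonempty unfolding inj_on_def disjoint_family_on_def
  by (metis Int_absorb)

text \<open>Label sets are nonempty, so pairwise disjointness indexed by the components already
  forces distinct label sets. It expresses injectivity and the disjointness of the blocks in one
  condition.\<close>

lemma planted_forests_eq: "planted_forests n = forests {2..n}"
proof -
  have "inj_on planted_labels P \<and> partition_on V (planted_labels ` P) \<longleftrightarrow>
      disjoint_family_on planted_labels P \<and> \<Union> (planted_labels ` P) = V" (is "?L \<longleftrightarrow> ?R")
    for P :: "nat planted set" and V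
  proof
    show ?R if L: ?L
    proof
      show "disjoint_family_on planted_labels P"
        unfolding disjoint_family_on_def
      proof (intro ballI impI)
        fix s t assume "s \<in> P" "t \<in> P" "s \<noteq> t"
        moreover from this have "planted_labels s \<noteq> planted_labels t"
          using L by (auto simp: inj_on_def)
        ultimately show "planted_labels s \<inter> planted_labels t = {}"
          using L by (auto simp: partition_on_def disjoint_def)
      qed
      show "\<Union> (planted_labels ` P) = V"
        using L by (simp add: partition_on_def)
    qed
    show ?L if ?R
    proof
      show "inj_on planted_labels P"
        using that by (intro inj_on_planted_labels) simp
      show "partition_on V (planted_labels ` P)"
      proof -
        have "planted_labels s \<inter> planted_labels t = {}"
          if "s \<in> P" "t \<in> P" "planted_labels s \<noteq> planted_labels t" for s t
          using \<open>?R\<close> that by (metis disjoint_family_on_def)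
        then have "disjoint (planted_labels ` P)"
          by (auto simp only: disjoint_def)
        moreover have "{} \<notin> planted_labels ` P"
          by (auto simp: image_iff dest: sym)
        ultimately show ?thesis using that by (simp add: partition_on_def)
      qed
    qed
  qed
  then show ?thesis by (auto simp: planted_forests_def forests_def)
qed

lemma forests_empty [simp]: "forests {} = {{}}"
  by (auto simp: forests_def disjoint_family_on_def)

lemma finite_forest:
  assumes "P \<in> forests V" "finite V"
  shows "finite P"
proof (rule finite_imageD[of planted_labels])
  have "planted_labels ` P \<subseteq> Pow V" using assms(1) by (auto simp: forests_def)
  then show "finite (planted_labels ` P)"
    by (rule finite_subset) (simp add: assms(2))
  show "inj_on planted_labels P"
    using assms(1) by (intro inj_on_planted_labels) (simp add: forests_def)
qed

text \<open>Singles out the component \<open>t\<close> containing \<open>m\<close>; \<open>U\<close>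
  consists of its other labels, and the remaining components form a forest on
  \<open>A - U\<close>.\<close>

lemma forests_insert:
  assumes "m \<notin> A"
  shows "forests (insert m A) = (\<lambda>(U, t, P). insert t P) `
    (SIGMA U:Pow A. components (insert m U) \<times> forests (A - U))" (is "_ = ?h ` ?X")
proof
  show "forests (insert m A) \<subseteq> ?h ` ?X"
  proof
    fix P assume P: "P \<in> forests (insert m A)"
    then obtain t where t: "t \<in> P" "m \<in> planted_labels t"
      by (fastforce simp: forests_def)
    define U where "U = planted_labels t - {m}"
    have lab: "planted_labels t = insert m U" using t by (auto simp: U_def)
    have "U \<subseteq> A" using P t by (auto simp: forests_def U_def)
    moreover have "t \<in> components (insert m U)"
      using P t lab by (auto simp: forests_def components_def)
    moreover have "P - {t} \<in> forests (A - U)"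
    proof -
      have dis: "planted_labels s \<inter> planted_labels t = {}" if "s \<in> P - {t}" for s
        using P t that by (auto simp: forests_def disjoint_family_on_def)
      have "\<Union> (planted_labels ` P) = insert m A" using P by (simp add: forests_def)
      moreover have "\<Union> (planted_labels ` P) =
          planted_labels t \<union> \<Union> (planted_labels ` (P - {t}))"
        using t by auto
      ultimately have "\<Union> (planted_labels ` (P - {t})) = insert m A - planted_labels t"
        using dis by blast
      also have "\<dots> = A - U" using lab assms by auto
      finally show ?thesis
        using P by (auto simp: forests_def disjoint_family_on_def)
    qed
    ultimately show "P \<in> ?h ` ?X"
      using t by (intro image_eqI[of _ _ "(U, t, P - {t})"]) auto
  qed
  show "?h ` ?X \<subseteq> forests (insert m A)"
  proof
    fix F assume "F \<in> ?h ` ?X"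
    then obtain U t P where F: "F = insert t P" "U \<subseteq> A" "t \<in> components (insert m U)"
      "P \<in> forests (A - U)"
      by auto
    then have "planted_labels t \<inter> planted_labels s = {}" if "s \<in> P" for s
      using that assms by (auto simp: forests_def components_def)
    then have "disjoint_family_on planted_labels F"
      using F unfolding disjoint_family_on_def forests_def by blast
    then show "F \<in> forests (insert m A)"
      using F by (auto simp: forests_def components_def)
  qed
qed

lemma component_notin_forest:
  assumes "t \<in> components (insert m U)" "P \<in> forests (A - U)" "m \<notin> A"
  shows "t \<notin> P"
  using assms by (auto simp: forests_def components_def)

text \<open>The singled-out component can be read off from the forest as the only one containing
  \<open>m\<close>.\<close>

lemma inj_on_insert_component:
  assumes "m \<notin> A"
  shows "inj_on (\<lambda>(U, t, P). insert t P)
    (SIGMA U:Pow A. components (insert m U) \<times> forests (A - U))"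
proof -
  have "U = U' \<and> t = t' \<and> P = P'"
    if "U \<subseteq> A" "t \<in> components (insert m U)" "P \<in> forests (A - U)"
      and "U' \<subseteq> A" "t' \<in> components (insert m U')" "P' \<in> forests (A - U')"
      and eq: "insert t P = insert t' P'"
    for U t P U' t' P'
  proof -
    have "t \<notin> P'"
      using that(2,6) assms by (auto simp: forests_def components_def)
    then have t: "t = t'" using eq by auto
    moreover have "U = U'"
      using that(1,2,4,5) assms unfolding t components_def by auto
    moreover have "P = P'"
      using eq that component_notin_forest assms unfolding t by (metis insert_ident)
    ultimately show ?thesis by simp
  qed
  then show ?thesis by (fastforce simp: inj_on_def)
qed

text \<open>The planted root is forced to be \<open>m\<close>. The two sets never occur together,
  since \<open>trees012 U\<close> is empty for empty \<open>U\<close>.\<close>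

lemma components_insert:
  assumes "finite U" "\<forall>a \<in> U. m < a"
  shows "components (insert m U) =
    (if U = {} then {Single_Root m} else {}) \<union> Planted_Root m ` trees012 U"
proof
  have Min: "Min (insert m U) = m"
    using assms by (intro Min_eqI) (auto dest: order.strict_implies_order)
  have m: "insert m U - {m} = U" using assms(2) by auto
  show "components (insert m U) \<subseteq>
      (if U = {} then {Single_Root m} else {}) \<union> Planted_Root m ` trees012 U"
  proof
    fix t assume t: "t \<in> components (insert m U)"
    show "t \<in> (if U = {} then {Single_Root m} else {}) \<union> Planted_Root m ` trees012 U"
    proof (cases t)
      case (Single_Root v)
      then have "insert m U = {v}" using t by (simp add: components_def)
      then have "v = m" "U = {}" using m by auto
      then show ?thesis using Single_Root by simp
    next
      case (Planted_Root v s)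
      have "planted_tree_on (insert m U) t" using t by (simp add: components_def)
      then have v: "v = m" and "increasing_tree012_on (insert m U - {v}) s"
        unfolding Planted_Root by (auto simp only: planted_tree_on.simps Min)
      then have "s \<in> trees012 U"
        unfolding v m trees012_def by simp
      then show ?thesis using Planted_Root v by simp
    qed
  qed
  show "(if U = {} then {Single_Root m} else {}) \<union> Planted_Root m ` trees012 U
      \<subseteq> components (insert m U)"
  proof -
    have "Planted_Root m s \<in> components (insert m U)" if "s \<in> trees012 U" for s
    proof -
      have "set (labels012 s) = U" "increasing_tree012_on (insert m U - {m}) s"
        using that by (simp_all only: m trees012_def increasing_tree012_on_def mem_Collect_eq)
      then show ?thesis
        using assms(1) unfolding components_def planted_tree_on.simps mem_Collect_eq Min by simp
    qed
    then show ?thesis by (auto simp: components_def)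
  qed
qed

lemma finite_components_insert:
  assumes "finite U" "\<forall>a \<in> U. m < a"
  shows "finite (components (insert m U))"
  using finite_trees012[OF assms(1)] by (simp add: components_insert[OF assms])

text \<open>With \<open>c = (\<alpha> + \<beta>) / 2\<close> and the 0-1-2-tree series
  \<open>Q\<close>, this is the factor \<open>c (x + y + 2 Q)\<close> of the differential equation
  for \<open>L R\<close>.\<close>

lemma sum_components_insert:
  fixes x y \<alpha> \<beta> :: "'b::field_char_0"
  assumes "finite U" "\<forall>a \<in> U. m < a"
  shows "sum (planted_weight x y \<alpha> \<beta>) (components (insert m U)) =
    (x + y) * ((\<alpha> + \<beta>) / 2) * set_unit U + (\<alpha> + \<beta>) * sum (weight012 x y) (trees012 U)"
proof -
  have "sum (planted_weight x y \<alpha> \<beta>) (components (insert m U)) =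
      sum (planted_weight x y \<alpha> \<beta>) (if U = {} then {Single_Root m} else {}) +
      sum (planted_weight x y \<alpha> \<beta>) (Planted_Root m ` trees012 U)"
    unfolding components_insert[OF assms] using assms(1) finite_trees012
    by (intro sum.union_disjoint) auto
  also have "sum (planted_weight x y \<alpha> \<beta>) (Planted_Root m ` trees012 U) =
      (\<alpha> + \<beta>) * sum (weight012 x y) (trees012 U)"
    by (subst sum.reindex) (auto simp: inj_on_def sum_distrib_left)
  finally show ?thesis by (simp add: set_unit_def)
qed

lemma finite_forests: "finite V \<Longrightarrow> finite (forests V)"
proof (induction rule: finite_min_strong_induct)
  case (insert m A)
  then have "m \<notin> A" by auto
  have "finite (components (insert m U))" if "U \<subseteq> A" for U
    using that insert.hyps by (intro finite_components_insert) (auto intro: finite_subset)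
  then show ?case
    unfolding forests_insert[OF \<open>m \<notin> A\<close>] using insert.hyps(1) insert.IH
    by (auto intro!: finite_imageI finite_SigmaI finite_cartesian_product)
qed simp

text \<open>The component containing \<open>m\<close> contributes the derivative of the component
  series, and the other components form an arbitrary forest on the labels left over.\<close>

lemma sum_forests_insert:
  fixes x y \<alpha> \<beta> :: "'b::field_char_0"
  assumes "finite A" "\<forall>a \<in> A. m < a"
  shows "sum (forest_weight x y \<alpha> \<beta>) (forests (insert m A)) =
    set_conv (\<lambda>U. sum (planted_weight x y \<alpha> \<beta>) (components (insert m U)))
      (\<lambda>U. sum (forest_weight x y \<alpha> \<beta>) (forests U)) A"
proof -
  let ?X = "SIGMA U:Pow A. components (insert m U) \<times> forests (A - U)"
  have m: "m \<notin> A" using assms(2) by auto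
  have "sum (forest_weight x y \<alpha> \<beta>) (forests (insert m A)) =
      (\<Sum>(U, t, P) \<in> ?X. forest_weight x y \<alpha> \<beta> (insert t P))"
    unfolding forests_insert[OF m] sum.reindex[OF inj_on_insert_component[OF m]]
    by (intro sum.cong) auto
  also have "\<dots> = (\<Sum>(U, t, P) \<in> ?X. planted_weight x y \<alpha> \<beta> t * forest_weight x y \<alpha> \<beta> P)"
  proof (intro sum.cong refl, clarify)
    fix U t P
    assume *: "t \<in> components (insert m U)" "P \<in> forests (A - U)"
    have "finite P" using finite_forest[OF *(2)] assms(1) by simp
    then show "forest_weight x y \<alpha> \<beta> (insert t P) =
        planted_weight x y \<alpha> \<beta> t * forest_weight x y \<alpha> \<beta> P"
      using component_notin_forest[OF * m] by (simp add: forest_weight_def)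
  qed
  also have "\<dots> = set_conv (\<lambda>U. sum (planted_weight x y \<alpha> \<beta>) (components (insert m U)))
      (\<lambda>U. sum (forest_weight x y \<alpha> \<beta>) (forests U)) A"
    using assms finite_subset[OF _ assms(1)]
    by (intro sum_split_conv finite_components_insert finite_forests) auto
  finally show ?thesis .
qed

text \<open>Both sides equal 1 on the empty set and satisfy the same linear differential equation,
  so induction on the label set identifies them.\<close>

lemma conv_left_right_eq_sum_forests:
  fixes x y \<alpha> \<beta> :: "'b::field_char_0" and V :: "'a::linorder set"
  defines "c \<equiv> (\<alpha> + \<beta>) / 2"
  defines "L \<equiv> \<lambda>S. sum (left_weight x y c) (heap_trees S)"
    and "R \<equiv> \<lambda>S. sum (right_weight x y c) (heap_trees S)"
  assumes "finite V"
  shows "set_conv L R V = sum (forest_weight x y \<alpha> \<beta>) (forests V)"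
  using assms(4)
proof (induction rule: finite_min_strong_induct)
  case empty
  then show ?case by (simp add: L_def R_def forest_weight_def)
next
  case (insert m A)
  \<comment> \<open>\<open>K x\<close> and \<open>K y\<close> are the series \<open>x + F\<close>
    and \<open>y + F\<close> of subtrees hanging to the left and to the right.\<close>
  define K where "K u S = sum (leaf_weight x y u) (heap_trees S)" for u and S :: "'a set"
  have m: "m \<notin> A" using insert.hyps by auto
  have L: "L (insert m S) = c * set_conv L (K y) S" if "S \<subseteq> A" for S
  proof -
    have "L (insert m S) =
        set_conv (\<lambda>S. \<Sum>l \<in> heap_trees S. c * left_weight x y c l) (K y) S"
      unfolding L_def K_def using that insert.hyps finite_subset
      by (intro sum_heap_trees_insert) auto
    then show ?thesis
      by (simp add: L_def sum_distrib_left [symmetric] set_conv_scale_left)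
  qed
  have R: "R (insert m S) = c * set_conv (K x) R S" if "S \<subseteq> A" for S
  proof -
    have "R (insert m S) =
        set_conv (K x) (\<lambda>S. \<Sum>r \<in> heap_trees S. c * right_weight x y c r) S"
      unfolding R_def K_def using that insert.hyps finite_subset
      by (intro sum_heap_trees_insert) auto
    then show ?thesis
      by (simp add: R_def sum_distrib_left [symmetric] set_conv_scale_right)
  qed
  have "set_conv L R (insert m A) =
      set_conv (\<lambda>S. L (insert m S)) R A + set_conv L (\<lambda>S. R (insert m S)) A"
    using insert.hyps(1) m by (rule set_conv_insert)
  also have "set_conv (\<lambda>S. L (insert m S)) R A =
      set_conv (\<lambda>S. c * set_conv (K y) L S) R A"
    by (intro set_conv_cong refl) (simp add: L set_conv_commute[of "K y"])
  \<comment> \<open>Regrouping restores the product of \<open>L\<close> and \<open>R\<close>, to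
    which the induction hypothesis applies on subsets of \<open>A\<close>.\<close>
  also have "\<dots> = c * set_conv (K y) (set_conv L R) A"
    using insert.hyps(1) by (simp add: set_conv_scale_left set_conv_assoc)
  also have "set_conv L (\<lambda>S. R (insert m S)) A = set_conv L (\<lambda>S. c * set_conv R (K x) S) A"
    by (intro set_conv_cong refl) (simp add: R set_conv_commute[of "K x"])
  also have "\<dots> = c * set_conv (K x) (set_conv L R) A"
    using insert.hyps(1)
    by (simp add: set_conv_scale_right set_conv_assoc [symmetric] set_conv_commute[of "K x"])
  also have "c * set_conv (K y) (set_conv L R) A + c * set_conv (K x) (set_conv L R) A =
      set_conv (\<lambda>S. c * (K y S + K x S)) (set_conv L R) A"
    by (simp add: set_conv_scale_left set_conv_add_left distrib_left)
  also have "\<dots> = set_conv (\<lambda>U. sum (planted_weight x y \<alpha> \<beta>) (components (insert m U)))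
      (\<lambda>U. sum (forest_weight x y \<alpha> \<beta>) (forests U)) A"
  proof (rule set_conv_cong)
    fix S assume "S \<subseteq> A"
    then have S: "finite S" "\<forall>a \<in> S. m < a"
      using insert.hyps finite_subset by auto
    \<comment> \<open>The two summands of the product rule each bring one \<open>c F\<close>;
      together they account for the label \<open>\<alpha> + \<beta> = 2 c\<close> of a root with a
      child.\<close>
    show "c * (K y S + K x S) = sum (planted_weight x y \<alpha> \<beta>) (components (insert m S))"
      unfolding K_def sum_components_insert[OF S] sum_leaf_weight_eq_sum_weight012[OF S(1)]
      by (simp add: c_def field_simps)
  qed (rule insert.IH)
  also have "\<dots> = sum (forest_weight x y \<alpha> \<beta>) (forests (insert m A))"
    using insert.hyps by (simp add: sum_forests_insert)
  finally show ?case .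
qed

theorem theorem3p3:
  fixes x y \<alpha> \<beta> :: "'a::field_char_0" and n :: nat
  assumes "n \<ge> 1"
  shows "(\<Sum>T \<in> increasing_binary_trees n.
            x ^ xleaf T * y ^ yleaf T * ((\<alpha> + \<beta>) / 2) ^ (N_alpha T + N_beta T))
       = (\<Sum>P \<in> planted_forests n. forest_weight x y \<alpha> \<beta> P)"
proof -
  \<comment> \<open>The label 1 is the root of the binary tree. Removing it leaves exactly the
    labels of the forests, none when \<open>n = 1\<close>.\<close>
  have "{1..n} = insert 1 {2..n}" using assms by auto
  then have "increasing_binary_trees n = heap_trees (insert 1 {2..n})"
    by (simp add: increasing_binary_trees_def heap_trees_def)
  then have "(\<Sum>T \<in> increasing_binary_trees n.
            x ^ xleaf T * y ^ yleaf T * ((\<alpha> + \<beta>) / 2) ^ (N_alpha T + N_beta T)) =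
      set_conv (\<lambda>S. sum (left_weight x y ((\<alpha> + \<beta>) / 2)) (heap_trees S))
        (\<lambda>S. sum (right_weight x y ((\<alpha> + \<beta>) / 2)) (heap_trees S)) {2..n}"
    by (simp only:) (intro sum_heap_trees_insert; simp add: binary_tree_weight_Node)
  also have "\<dots> = (\<Sum>P \<in> planted_forests n. forest_weight x y \<alpha> \<beta> P)"
    unfolding planted_forests_eq by (rule conv_left_right_eq_sum_forests) simp
  finally show ?thesis .
qed

end
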